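(* Let $\lambda\ge 0$, $0\le\alpha<1$, $0\le k<\infty$, $u\in\mathbb{N}=\{1,2,3,\dots\}$, $v\in\mathbb{N}_0=\mathbb{N}\cup\{0\}$ with $u>v$. Let $f_u,g_u\in k\text{-}UTH(u,v,\alpha,\lambda)$, where $$f_u(z)=z-\sum_{n=2}^\infty|a_n|z^n+(-1)^{u-1}\sum_{n=1}^\infty|b_n|\overline{z}^n,\qquad g_u(z)=z-\sum_{n=2}^\infty|c_n|z^n+(-1)^{u-1}\sum_{n=1}^\infty|d_n|\overline{z}^n.$$ Then the convolution $$(f_u*g_u)(z)=f_u(z)*g_u(z)=z-\sum_{n=2}^\infty|a_nc_n|z^n+(-1)^{u-1}\sum_{n=1}^\infty|b_nd_n|\overline{z}^n$$ belongs to $k\text{-}UTH(u,v,\alpha,\lambda)$.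
   Context: $U=\{z\in\mathbb{C}:|z|<1\}$. $SH$ is the class of functions $f=h+\overline{g}$ ($h,g$ analytic in $U$) that are harmonic, univalent and sense-preserving in $U$ with $f(0)=0$, $f_z(0)=1$; $h$ and $g$ are written $h(z)=z+\sum_{n\ge2}a_nz^n$, $g(z)=\sum_{n\ge1}b_nz^n$, $|b_1|<1$. Al-Oboudi operator: for $\lambda\ge0$ and $u\in\mathbb{N}_0$, $D^uh(z)=z+\sum_{n=2}^\infty[1+(n-1)\lambda]^ua_nz^n$, $D^ug(z)=\sum_{n=1}^\infty[1+(n-1)\lambda]^ub_nz^n$, and $D^uf(z)=D^uh(z)+(-1)^u\overline{D^ug(z)}$. For $0\le\alpha<1$, $0\le k<\infty$, $u\in\mathbb{N}$, $v\in\mathbb{N}_0$, $u>v$, $\lambda\ge0$, the class $k\text{-}USH(u,v,\alpha,\lambda)$ consists of the functions $f=h+\overline{g}\in SH$ satisfying $$\operatorname{Re}\left\{(1+ke^{i\phi})\frac{D^uf(z)}{D^vf(z)}-ke^{i\phi}\right\}\ge\alpha$$ for all $z\in U\setminus\{0\}$ and all real $\phi$. The subclass $k\text{-}UTH(u,v,\alpha,\lambda)$ of $k\text{-}USH(u,v,\alpha,\lambda)$ consists of those members of the form $h+\overline{g}$ with $h(z)=z-\sum_{n\ge2}|a_n|z^n$, $g(z)=(-1)^{u-1}\sum_{n\ge1}|b_n|z^n$, $|b_1|<1$. (In the claim, $g_u$ denotes a second harmonic function of the class, not the co-analytic part of $f_u$.) *)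

theory Defs
  imports "HOL-Complex_Analysis.Complex_Analysis"
begin

abbreviation unit_disk :: "complex set" where
  "unit_disk \<equiv> ball 0 1"

text \<open>The Wirtinger derivatives are the combinations \<open>(f\<^sub>x - i f\<^sub>y)/2\<close> and \<open>(f\<^sub>x + i f\<^sub>y)/2\<close>
  of the partial derivatives of \<open>f\<close>, obtained from the real Frechet derivative in the directions
  \<open>1\<close> and \<open>i\<close>.\<close>

definition wirtinger :: "(complex \<Rightarrow> complex) \<Rightarrow> complex \<Rightarrow> complex" where
  "wirtinger f z =
     (frechet_derivative f (at z) 1 - \<i> * frechet_derivative f (at z) \<i>) / 2"

definition wirtinger_bar :: "(complex \<Rightarrow> complex) \<Rightarrow> complex \<Rightarrow> complex" where
  "wirtinger_bar f z =
     (frechet_derivative f (at z) 1 + \<i> * frechet_derivative f (at z) \<i>) / 2"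

text \<open>A differentiable map is sense-preserving when its real Jacobian determinant, which equals
  \<open>|f\<^sub>z|^2\<close> minus the squared modulus of the conjugate Wirtinger derivative, is positive.\<close>

definition sense_preserving_on :: "(complex \<Rightarrow> complex) \<Rightarrow> complex set \<Rightarrow> bool" where
  "sense_preserving_on f S \<longleftrightarrow>
     (\<forall>z\<in>S. f differentiable (at z) \<and>
            (norm (wirtinger f z))\<^sup>2 - (norm (wirtinger_bar f z))\<^sup>2 > 0)"

text \<open>The canonical decomposition \<open>f = h + cnj g\<close>. Such an \<open>f\<close> is harmonic in the disk. The power
  series of \<open>h\<close> and \<open>g\<close> have no constant term; with this normalization \<open>h\<close> and \<open>g\<close> are determined
  on the disk by \<open>f\<close>.\<close>

definition harmonic_parts ::
    "(complex \<Rightarrow> complex) \<Rightarrow> (complex \<Rightarrow> complex) \<Rightarrow> (complex \<Rightarrow> complex) \<Rightarrow> bool" where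
  "harmonic_parts f h g \<longleftrightarrow>
     h holomorphic_on unit_disk \<and> g holomorphic_on unit_disk \<and> h 0 = 0 \<and> g 0 = 0 \<and>
     (\<forall>z\<in>unit_disk. f z = h z + cnj (g z))"

definition SH :: "(complex \<Rightarrow> complex) set" where
  "SH = {f. (\<exists>h g. harmonic_parts f h g) \<and> inj_on f unit_disk \<and>
            sense_preserving_on f unit_disk \<and> f 0 = 0 \<and> wirtinger f 0 = 1}"

text \<open>The coefficient of \<open>z^n\<close> is multiplied by \<open>(1 + (n-1)lam)^u\<close> for \<open>n \<ge> 1\<close>; the sum
  below is shifted by one. The same formula serves the analytic part \<open>h\<close>, whose leading coefficient
  is \<open>1\<close>, and the co-analytic part \<open>g\<close>.\<close>

definition al_oboudi :: "real \<Rightarrow> nat \<Rightarrow> (complex \<Rightarrow> complex) \<Rightarrow> complex \<Rightarrow> complex" where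
  "al_oboudi lam u p z =
     (\<Sum>n. of_real ((1 + real n * lam) ^ u) * fps_nth (fps_expansion p 0) (n + 1) * z ^ (n + 1))"

definition al_oboudi_harmonic ::
    "real \<Rightarrow> nat \<Rightarrow> (complex \<Rightarrow> complex) \<Rightarrow> (complex \<Rightarrow> complex) \<Rightarrow> complex \<Rightarrow> complex" where
  "al_oboudi_harmonic lam u h g z =
     al_oboudi lam u h z + (-1) ^ u * cnj (al_oboudi lam u g z)"

text \<open>Division by zero is total in HOL, so that the quotient is defined has to be required
  explicitly.\<close>

definition kUSH :: "real \<Rightarrow> nat \<Rightarrow> nat \<Rightarrow> real \<Rightarrow> real \<Rightarrow> (complex \<Rightarrow> complex) set" where
  "kUSH k u v \<alpha> lam = {f \<in> SH. \<exists>h g. harmonic_parts f h g \<and>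
     (\<forall>z\<in>unit_disk - {0}.
        al_oboudi_harmonic lam v h g z \<noteq> 0 \<and>
        (\<forall>\<phi>::real.
           Re ((1 + of_real k * exp (\<i> * of_real \<phi>)) *
                 (al_oboudi_harmonic lam u h g z / al_oboudi_harmonic lam v h g z)
               - of_real k * exp (\<i> * of_real \<phi>)) \<ge> \<alpha>))}"

text \<open>Only the values \<open>a n\<close> for \<open>n \<ge> 2\<close> and \<open>b n\<close> for \<open>n \<ge> 1\<close> are used.\<close>

definition neg_series :: "nat \<Rightarrow> (nat \<Rightarrow> complex) \<Rightarrow> (nat \<Rightarrow> complex) \<Rightarrow> complex \<Rightarrow> complex" where
  "neg_series u a b z =
     z - (\<Sum>n. of_real (norm (a (n + 2))) * z ^ (n + 2))
       + (-1) ^ (u - 1) * (\<Sum>n. of_real (norm (b (n + 1))) * cnj z ^ (n + 1))"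

definition has_neg_series ::
    "nat \<Rightarrow> (complex \<Rightarrow> complex) \<Rightarrow> (nat \<Rightarrow> complex) \<Rightarrow> (nat \<Rightarrow> complex) \<Rightarrow> bool" where
  "has_neg_series u f a b \<longleftrightarrow>
     (\<forall>z\<in>unit_disk.
        summable (\<lambda>n. of_real (norm (a (n + 2))) * z ^ (n + 2)) \<and>
        summable (\<lambda>n. of_real (norm (b (n + 1))) * cnj z ^ (n + 1)) \<and>
        f z = neg_series u a b z)"

definition kUTH :: "real \<Rightarrow> nat \<Rightarrow> nat \<Rightarrow> real \<Rightarrow> real \<Rightarrow> (complex \<Rightarrow> complex) set" where
  "kUTH k u v \<alpha> lam =
     {f \<in> kUSH k u v \<alpha> lam. \<exists>a b. has_neg_series u f a b \<and> norm (b 1) < 1}"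

text \<open>The convolution of two such series is defined by the modulus of the products of
  coefficients and keeps the sign pattern of the class. It is not the plain coefficientwise
  (Hadamard) product of the parts, whose signs would differ.\<close>

definition neg_convolution ::
    "nat \<Rightarrow> (nat \<Rightarrow> complex) \<Rightarrow> (nat \<Rightarrow> complex) \<Rightarrow> (nat \<Rightarrow> complex) \<Rightarrow> (nat \<Rightarrow> complex)
      \<Rightarrow> complex \<Rightarrow> complex" where
  "neg_convolution u a b c d = neg_series u (\<lambda>n. a n * c n) (\<lambda>n. b n * d n)"

end

theory Submission
  imports Defs
begin

text \<open>
  Write \<open>A n\<close> and \<open>B n\<close> for the moduli of the coefficients of \<open>z\<^sup>n\<^sup>+\<^sup>1\<close> and of its conjugate
  (with \<open>A 0 = 0\<close>), \<open>w n = 1 + n lam\<close>, and let \<open>s\<close> be the sign \<open>(-1) ^ (u + v)\<close>. A function of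
  this shape with \<open>B 0 < 1\<close> lies in the class exactly if two linear inequalities hold:
  \<open>\<Sum>(n + 1)(A n + B n) \<le> 1\<close>, which is univalence together with preservation of orientation, and
  \<open>\<Sum>(e n * A n + e' n * B n) \<le> 1 - \<alpha>\<close> with \<open>e n = (1 + k) (w n)\<^sup>u - (k + \<alpha>) (w n)\<^sup>v\<close> and
  \<open>e' n = (1 + k) (w n)\<^sup>u - s (k + \<alpha>) (w n)\<^sup>v\<close>. All weights are nonnegative, so both
  inequalities survive when the coefficients shrink. The first inequality bounds the coefficients of
  the second factor by \<open>1\<close>; hence the convolution has smaller coefficients than the first factor
  and stays in the class.

  Necessity comes from the positive real axis, where all terms have a fixed sign. There the Jacobian
  cannot vanish, so the real function \<open>1 - \<Sum>(n + 1) A n r\<^sup>n\<close> keeps the positive sign it has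
  at \<open>0\<close> and exceeds \<open>\<Sum>(n + 1) B n r\<^sup>n\<close>; letting \<open>r\<close> tend to \<open>1\<close> gives the first inequality
  (\<open>partial_sums_le_if_SH\<close>). In the same way \<open>D\<^sup>v f / r\<close> stays positive, so that the defining
  inequality with \<open>\<phi> = 0\<close> can be multiplied by it, which gives the second one
  (\<open>partial_sums_le_if_kUSH\<close>).

  For sufficiency, the first inequality makes \<open>f\<close> differ from the identity by a strict contraction on
  each smaller disk (\<open>neg_map_in_SH\<close>). For the second, put \<open>W = D\<^sup>u f / D\<^sup>v f\<close>;
  the condition for all \<open>\<phi>\<close> follows from \<open>Re W - k |W - 1| \<ge> \<alpha>\<close>. A direct bound of \<open>|W - 1|\<close>
  loses too much when \<open>s = -1\<close>, because \<open>D\<^sup>u f\<close> and \<open>D\<^sup>v f\<close> then contain the conjugate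
  powers with opposite signs. With the half sum \<open>p\<close> and the half difference \<open>q\<close> of \<open>D\<^sup>v f\<close> and
  \<open>D\<^sup>u f\<close>, however, \<open>Re ((p - q) cnj (p + q)) = |p|\<^sup>2 - |q|\<^sup>2\<close>, and
  \<open>(1 + \<alpha> + 2 k) |q| \<le> (1 - \<alpha>) |p|\<close> suffices (\<open>Re_quotient_ge\<close>). The triangle inequality
  turns this last condition into exactly the second coefficient inequality
  (\<open>al_oboudi_harmonic_difference_le\<close>).
\<close>

section \<open>Power series with real coefficients on the unit disk\<close>

definition disk_coeffs :: "(nat \<Rightarrow> real) \<Rightarrow> bool" where
  "disk_coeffs c \<longleftrightarrow> (\<forall>r. 0 \<le> r \<longrightarrow> r < 1 \<longrightarrow> summable (\<lambda>n. \<bar>c n\<bar> * r ^ n))"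

definition power_sum :: "(nat \<Rightarrow> real) \<Rightarrow> complex \<Rightarrow> complex" where
  "power_sum c z = (\<Sum>n. of_real (c n) * z ^ n)"

text \<open>The factor \<open>z\<close> in front makes the index \<open>n\<close> start at the coefficient of \<open>z\<^sup>1\<close>, as in the
  Al-Oboudi operator; its weights are then \<open>1 + n lam\<close>.\<close>

definition shifted_sum :: "(nat \<Rightarrow> real) \<Rightarrow> complex \<Rightarrow> complex" where
  "shifted_sum c z = z * power_sum c z"

lemma disk_coeffs_summable_norm:
  assumes "disk_coeffs c" "norm z < 1"
  shows "summable (\<lambda>n. norm (complex_of_real (c n) * z ^ n))"
  using assms unfolding disk_coeffs_def by (simp add: norm_mult norm_power)

lemma disk_coeffs_summable:
  assumes "disk_coeffs c" "norm z < 1"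
  shows "summable (\<lambda>n. complex_of_real (c n) * z ^ n)"
  using disk_coeffs_summable_norm[OF assms] by (rule summable_norm_cancel)

lemma disk_coeffs_summable_real:
  assumes "disk_coeffs c" "\<bar>r\<bar> < 1"
  shows "summable (\<lambda>n. c n * r ^ n)"
proof -
  have "summable (\<lambda>n. \<bar>c n\<bar> * \<bar>r\<bar> ^ n)"
    using assms unfolding disk_coeffs_def by simp
  hence "summable (\<lambda>n. norm (c n * r ^ n))"
    by (simp add: abs_mult power_abs)
  thus ?thesis by (rule summable_norm_cancel)
qed

lemma disk_coeffs_linear:
  assumes "disk_coeffs c" "disk_coeffs d"
  shows "disk_coeffs (\<lambda>n. x * c n + y * d n)"
  unfolding disk_coeffs_def
proof (intro allI impI)
  fix r :: real assume r: "0 \<le> r" "r < 1"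
  have "summable (\<lambda>n. \<bar>x\<bar> * (\<bar>c n\<bar> * r ^ n) + \<bar>y\<bar> * (\<bar>d n\<bar> * r ^ n))"
    using assms r unfolding disk_coeffs_def by (intro summable_add summable_mult) auto
  thus "summable (\<lambda>n. \<bar>x * c n + y * d n\<bar> * r ^ n)"
  proof (rule summable_comparison_test'[where N = 0])
    fix n :: nat
    have "\<bar>x * c n + y * d n\<bar> \<le> \<bar>x\<bar> * \<bar>c n\<bar> + \<bar>y\<bar> * \<bar>d n\<bar>"
      by (metis abs_mult abs_triangle_ineq)
    thus "norm (\<bar>x * c n + y * d n\<bar> * r ^ n)
        \<le> \<bar>x\<bar> * (\<bar>c n\<bar> * r ^ n) + \<bar>y\<bar> * (\<bar>d n\<bar> * r ^ n)"
      using r mult_right_mono[of "\<bar>x * c n + y * d n\<bar>" "\<bar>x\<bar> * \<bar>c n\<bar> + \<bar>y\<bar> * \<bar>d n\<bar>" "r ^ n"]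
      by (simp add: abs_mult distrib_right mult.assoc)
  qed
qed

lemma disk_coeffs_add: "disk_coeffs c \<Longrightarrow> disk_coeffs d \<Longrightarrow> disk_coeffs (\<lambda>n. c n + d n)"
  using disk_coeffs_linear[of c d 1 1] by simp

lemma disk_coeffs_diff: "disk_coeffs c \<Longrightarrow> disk_coeffs d \<Longrightarrow> disk_coeffs (\<lambda>n. c n - d n)"
  using disk_coeffs_linear[of c d 1 "-1"] by simp

lemma disk_coeffs_cmult: "disk_coeffs c \<Longrightarrow> disk_coeffs (\<lambda>n. x * c n)"
  using disk_coeffs_linear[of c c x 0] by simp

lemma disk_coeffs_one: "disk_coeffs (\<lambda>n. of_bool (n = 0))"
  unfolding disk_coeffs_def
proof (intro allI impI)
  fix r :: real
  show "summable (\<lambda>n. \<bar>of_bool (n = 0)\<bar> * r ^ n)"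
    by (rule summable_finite[of "{0}"]) auto
qed

text \<open>The geometric majorant absorbs the linear factor: for \<open>r < s < 1\<close> the sequence
  \<open>n (r / s)\<^sup>n\<close> is bounded. Taking \<open>lam = 1\<close> covers differentiation.\<close>

lemma disk_coeffs_affine_weight:
  assumes c: "disk_coeffs c"
  shows "disk_coeffs (\<lambda>n. (1 + real n * lam) * c n)"
  unfolding disk_coeffs_def
proof (intro allI impI)
  fix r :: real assume r: "0 \<le> r" "r < 1"
  define s where "s = (1 + r) / 2"
  have s: "0 < s" "s < 1" "r < s" using r by (auto simp: s_def)
  define x where "x = r / s"
  have x: "0 \<le> x" "x < 1" using r s by (auto simp: x_def)
  have "(\<lambda>n. x ^ n + lam * (real n * x ^ n)) \<longlonglongrightarrow> 0 + lam * 0"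
    using x by (intro tendsto_intros LIMSEQ_power_zero powser_times_n_limit_0) auto
  hence "Bseq (\<lambda>n. x ^ n + lam * (real n * x ^ n))"
    by (intro convergent_imp_Bseq) (auto simp: convergent_def)
  then obtain K where K: "\<And>n. norm (x ^ n + lam * (real n * x ^ n)) \<le> K"
    by (auto simp: Bseq_def)
  have "summable (\<lambda>n. K * (\<bar>c n\<bar> * s ^ n))"
    using c s unfolding disk_coeffs_def by (intro summable_mult) auto
  thus "summable (\<lambda>n. \<bar>(1 + real n * lam) * c n\<bar> * r ^ n)"
  proof (rule summable_comparison_test'[where N = 0])
    fix n :: nat
    have "r ^ n = x ^ n * s ^ n" using s by (simp add: x_def power_divide)
    hence "norm (\<bar>(1 + real n * lam) * c n\<bar> * r ^ n)
        = (\<bar>1 + real n * lam\<bar> * x ^ n) * (\<bar>c n\<bar> * s ^ n)"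
      using x s by (simp add: abs_mult)
    also have "\<bar>1 + real n * lam\<bar> * x ^ n = \<bar>(1 + real n * lam) * x ^ n\<bar>"
      using x by (simp add: abs_mult)
    also have "\<dots> = norm (x ^ n + lam * (real n * x ^ n))"
      by (simp add: algebra_simps)
    also have "norm (x ^ n + lam * (real n * x ^ n)) * (\<bar>c n\<bar> * s ^ n) \<le> K * (\<bar>c n\<bar> * s ^ n)"
      using K[of n] s by (intro mult_right_mono) auto
    finally show "norm (\<bar>(1 + real n * lam) * c n\<bar> * r ^ n) \<le> K * (\<bar>c n\<bar> * s ^ n)" .
  qed
qed

lemma disk_coeffs_weight:
  assumes "disk_coeffs c"
  shows "disk_coeffs (\<lambda>n. (1 + real n * lam) ^ u * c n)"
proof (induction u)
  case 0 thus ?case using assms by simp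
next
  case (Suc u)
  thus ?case using disk_coeffs_affine_weight[OF Suc, of lam] by (simp add: mult.assoc)
qed

lemma power_sum_linear:
  assumes "disk_coeffs c" "disk_coeffs d" "norm z < 1"
  shows "power_sum (\<lambda>n. x * c n + y * d n) z = of_real x * power_sum c z + of_real y * power_sum d z"
proof -
  note s = disk_coeffs_summable[OF assms(1,3)] disk_coeffs_summable[OF assms(2,3)]
  have "(\<lambda>n. of_real x * (of_real (c n) * z ^ n) + of_real y * (of_real (d n) * z ^ n)) sums
      (of_real x * power_sum c z + of_real y * power_sum d z)"
    unfolding power_sum_def by (intro sums_add sums_mult summable_sums s)
  thus ?thesis
    unfolding power_sum_def by (intro sums_unique[symmetric]) (simp add: algebra_simps)
qed

lemma power_sum_diff:
  "disk_coeffs c \<Longrightarrow> disk_coeffs d \<Longrightarrow> norm z < 1 \<Longrightarrow>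
    power_sum (\<lambda>n. c n - d n) z = power_sum c z - power_sum d z"
  using power_sum_linear[of c d z 1 "-1"] by simp

lemma power_sum_cmult:
  "disk_coeffs c \<Longrightarrow> norm z < 1 \<Longrightarrow> power_sum (\<lambda>n. x * c n) z = of_real x * power_sum c z"
  using power_sum_linear[of c c z x 0] by simp

lemma power_sum_one: "power_sum (\<lambda>n. of_bool (n = 0)) z = 1"
  unfolding power_sum_def by (subst suminf_finite[of "{0}"]) auto

lemma power_sum_of_real:
  assumes "disk_coeffs c" "\<bar>r\<bar> < 1"
  shows "power_sum c (of_real r) = of_real (\<Sum>n. c n * r ^ n)"
  unfolding power_sum_def
  by (subst suminf_of_real[OF disk_coeffs_summable_real[OF assms]]) simp

lemma cnj_power_sum:
  assumes "disk_coeffs c" "norm z < 1"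
  shows "cnj (power_sum c z) = power_sum c (cnj z)"
proof -
  have "(\<lambda>n. cnj (of_real (c n) * z ^ n)) sums cnj (power_sum c z)"
    unfolding sums_cnj power_sum_def by (intro summable_sums disk_coeffs_summable assms)
  thus ?thesis unfolding power_sum_def by (simp add: sums_iff)
qed

lemma norm_power_sum_le:
  assumes c: "disk_coeffs c" "\<And>n. 0 \<le> c n" and z: "norm z \<le> r" "r < 1"
  shows "norm (power_sum c z) \<le> (\<Sum>n. c n * r ^ n)"
proof -
  have "norm (power_sum c z) \<le> (\<Sum>n. norm (of_real (c n) * z ^ n))"
    unfolding power_sum_def using z by (intro summable_norm disk_coeffs_summable_norm c) auto
  also have "\<dots> = (\<Sum>n. c n * norm z ^ n)"
    using c by (simp add: norm_mult norm_power)
  also have "\<dots> \<le> (\<Sum>n. c n * r ^ n)"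
    using z c norm_ge_zero[of z] by (intro suminf_le mult_left_mono power_mono
        disk_coeffs_summable_real) (auto simp del: norm_ge_zero)
  finally show ?thesis .
qed

lemma suminf_power_add:
  fixes r :: real
  assumes "disk_coeffs c" "disk_coeffs d" "\<bar>r\<bar> < 1"
  shows "(\<Sum>n. (c n + d n) * r ^ n) = (\<Sum>n. c n * r ^ n) + (\<Sum>n. d n * r ^ n)"
  using assms by (simp add: suminf_add disk_coeffs_summable_real distrib_right)

lemma suminf_power_one: "(\<Sum>n. of_bool (n = 0) * r ^ n) = (1 :: real)"
  by (subst suminf_finite[of "{0}"]) auto

lemma shifted_sum_deriv:
  assumes c: "disk_coeffs c" and z: "norm z < 1"
  shows "(shifted_sum c has_field_derivative power_sum (\<lambda>n. (1 + real n) * c n) z) (at z within S)"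
proof -
  \<comment> \<open>The index of the coefficients is shifted back, so that termwise differentiation applies.\<close>
  define c' where "c' = (\<lambda>n. case n of 0 \<Rightarrow> 0 | Suc m \<Rightarrow> complex_of_real (c m))"
  have sums: "(\<lambda>n. c' n * w ^ n) sums shifted_sum c w" if "norm w < 1" for w
  proof -
    have "(\<lambda>n. w * (of_real (c n) * w ^ n)) sums shifted_sum c w"
      unfolding shifted_sum_def power_sum_def
      by (intro sums_mult summable_sums disk_coeffs_summable c that)
    hence "(\<lambda>n. c' (Suc n) * w ^ Suc n) sums shifted_sum c w"
      by (simp add: c'_def mult_ac)
    hence "(\<lambda>n. c' n * w ^ n) sums (shifted_sum c w + c' 0 * w ^ 0)" by (rule sums_Suc)
    thus ?thesis by (simp add: c'_def)
  qed
  have "((\<lambda>z. \<Sum>n. c' n * z ^ n) has_field_derivative (\<Sum>n. diffs c' n * z ^ n)) (at z)"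
    by (rule termdiffs_strong'[where K = 1]) (use sums z in \<open>auto simp: sums_iff\<close>)
  moreover have "(\<Sum>n. diffs c' n * z ^ n) = power_sum (\<lambda>n. (1 + real n) * c n) z"
    by (simp add: power_sum_def diffs_def c'_def)
  ultimately have "((\<lambda>z. \<Sum>n. c' n * z ^ n) has_field_derivative
      power_sum (\<lambda>n. (1 + real n) * c n) z) (at z)" by simp
  hence "(shifted_sum c has_field_derivative power_sum (\<lambda>n. (1 + real n) * c n) z) (at z)"
    by (rule has_field_derivative_transform_within_open[where S = "ball 0 1"])
       (use sums z in \<open>auto simp: sums_iff\<close>)
  thus ?thesis by (rule has_field_derivative_at_within)
qed

lemma shifted_sum_holomorphic:
  assumes "disk_coeffs c"
  shows "shifted_sum c holomorphic_on unit_disk"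
  unfolding holomorphic_on_def field_differentiable_def
proof (intro ballI exI)
  fix z :: complex assume "z \<in> unit_disk"
  thus "(shifted_sum c has_field_derivative power_sum (\<lambda>n. (1 + real n) * c n) z)
      (at z within unit_disk)"
    by (intro shifted_sum_deriv assms) simp
qed

lemma shifted_sum_0 [simp]: "shifted_sum c 0 = 0"
  by (simp add: shifted_sum_def)

text \<open>The operator reads off Taylor coefficients, so it depends only on the germ of the function at
  \<open>0\<close>, and on a convergent series it acts by multiplying coefficients.\<close>

lemma al_oboudi_shifted_sum:
  assumes c: "disk_coeffs c" and h: "\<And>z. z \<in> unit_disk \<Longrightarrow> h z = shifted_sum c z"
    and z: "norm z < 1"
  shows "al_oboudi lam u h z = shifted_sum (\<lambda>n. (1 + real n * lam) ^ u * c n) z"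
proof -
  have ev: "eventually (\<lambda>z. z \<in> unit_disk) (nhds (0::complex))"
    by (intro eventually_nhds_in_open) auto
  have "power_sum c has_fps_expansion Abs_fps (\<lambda>n. of_real (c n))"
    by (rule has_fps_expansionI, rule eventually_mono[OF ev])
       (auto simp: power_sum_def intro!: summable_sums disk_coeffs_summable c)
  hence "shifted_sum c has_fps_expansion fps_X * Abs_fps (\<lambda>n. of_real (c n))"
    unfolding shifted_sum_def[abs_def] by (intro fps_expansion_intros)
  hence "fps_expansion (shifted_sum c) 0 = fps_X * Abs_fps (\<lambda>n. of_real (c n))"
    by (rule fps_expansion_eqI)
  moreover have "fps_expansion h 0 = fps_expansion (shifted_sum c) 0"
    by (rule fps_expansion_cong, rule eventually_mono[OF ev]) (use h in auto)
  ultimately have nth: "fps_nth (fps_expansion h 0) (n + 1) = of_real (c n)" for n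
    by simp
  have "(\<lambda>n. z * (of_real ((1 + real n * lam) ^ u * c n) * z ^ n)) sums
      shifted_sum (\<lambda>n. (1 + real n * lam) ^ u * c n) z"
    unfolding shifted_sum_def power_sum_def
    by (intro sums_mult summable_sums disk_coeffs_summable disk_coeffs_weight c z)
  thus ?thesis unfolding al_oboudi_def nth
    by (intro sums_unique[symmetric]) (simp add: mult_ac)
qed

section \<open>Series with nonnegative terms\<close>

text \<open>A finite partial sum is continuous in \<open>r\<close>, so its bound passes to the limit \<open>r = 1\<close> even where
  nothing is known about the full series at \<open>1\<close>. Partial sums are also the form in which termwise
  comparison is immediate.\<close>

lemma partial_sums_le_if_Abel_sums_le:
  fixes c :: "nat \<Rightarrow> real"
  assumes nonneg: "\<And>n. 0 \<le> c n" and c: "disk_coeffs c"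
    and le: "\<And>r. 0 < r \<Longrightarrow> r < 1 \<Longrightarrow> (\<Sum>n. c n * r ^ n) \<le> C"
  shows "sum c {..<N} \<le> C"
proof -
  have "((\<lambda>r. \<Sum>n<N. c n * r ^ n) \<longlongrightarrow> (\<Sum>n<N. c n * 1 ^ n)) (at_left (1::real))"
    by (intro tendsto_intros)
  moreover have "eventually (\<lambda>r. (\<Sum>n<N. c n * r ^ n) \<le> C) (at_left (1::real))"
  proof -
    have "(\<Sum>n<N. c n * r ^ n) \<le> C" if r: "r \<in> {0<..<1}" for r
    proof -
      have "(\<Sum>n<N. c n * r ^ n) \<le> (\<Sum>n. c n * r ^ n)"
        by (intro sum_le_suminf disk_coeffs_summable_real c) (use r nonneg in auto)
      thus ?thesis using le[of r] r by auto
    qed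
    thus ?thesis by (intro eventually_mono[OF eventually_at_left_real[of 0 1]]) auto
  qed
  ultimately have "(\<Sum>n<N. c n * 1 ^ n) \<le> C"
    by (rule tendsto_upperbound) simp
  thus ?thesis by simp
qed

lemma disk_coeffs_if_partial_sums_le:
  assumes nonneg: "\<And>n. 0 \<le> c n" and le: "\<And>N. sum c {..<N} \<le> C"
  shows "disk_coeffs c"
  unfolding disk_coeffs_def
proof (intro allI impI)
  fix r :: real assume r: "0 \<le> r" "r < 1"
  have "summable c" by (rule summableI_nonneg_bounded[OF nonneg le])
  thus "summable (\<lambda>n. \<bar>c n\<bar> * r ^ n)"
    by (rule summable_comparison_test'[where N = 0])
       (use r nonneg in \<open>auto simp: abs_mult power_le_one intro!: mult_left_le\<close>)
qed

text \<open>Every term but the first gains a factor \<open>r\<close>. This is what makes a nonstrict bound on the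
  coefficients strict inside the disk.\<close>

lemma Abel_sum_le:
  fixes c :: "nat \<Rightarrow> real"
  assumes nonneg: "\<And>n. 0 \<le> c n" and le: "\<And>N. sum c {..<N} \<le> C"
    and r: "0 \<le> r" "r < 1"
  shows "(\<Sum>n. c n * r ^ n) \<le> c 0 + r * (C - c 0)"
proof -
  have "(\<Sum>n<N. c n * r ^ n) \<le> c 0 + r * (C - c 0)" for N
  proof -
    have "(\<Sum>n<N. c n * r ^ n) \<le> (\<Sum>n<Suc N. c n * r ^ n)"
      using nonneg r by simp
    also have "\<dots> = c 0 + (\<Sum>n<N. c (Suc n) * r ^ Suc n)"
      by (subst sum.lessThan_Suc_shift) simp
    also have "(\<Sum>n<N. c (Suc n) * r ^ Suc n) \<le> (\<Sum>n<N. c (Suc n) * r)"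
    proof (intro sum_mono mult_left_mono nonneg)
      fix n show "r ^ Suc n \<le> r" using r by (simp add: mult_left_le power_le_one)
    qed
    also have "\<dots> = r * (sum c {..<Suc N} - c 0)"
      by (subst sum.lessThan_Suc_shift) (simp flip: sum_distrib_right)
    also have "\<dots> \<le> r * (C - c 0)"
      using r le[of "Suc N"] by (intro mult_left_mono) auto
    finally show ?thesis by simp
  qed
  moreover have "summable (\<lambda>n. c n * r ^ n)"
    using disk_coeffs_summable_real[OF disk_coeffs_if_partial_sums_le[OF nonneg le]] r by auto
  ultimately show ?thesis by (intro suminf_le_const)
qed

lemma Abel_sum_less_1:
  fixes c :: "nat \<Rightarrow> real"
  assumes nonneg: "\<And>n. 0 \<le> c n" and le: "\<And>N. sum c {..<N} \<le> 1"
    and c0: "c 0 < 1" and r: "0 \<le> r" "r < 1"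
  shows "(\<Sum>n. c n * r ^ n) < 1"
proof -
  have "r * (1 - c 0) < 1 * (1 - c 0)" using c0 r by (intro mult_strict_right_mono) auto
  thus ?thesis using Abel_sum_le[OF nonneg le r] by simp
qed

text \<open>Turns nonvanishing into a sign by the intermediate value theorem. It is applied to the derivative of
  the analytic part and to \<open>D\<^sup>v f / r\<close> on the positive real axis.\<close>

lemma power_series_positive:
  fixes c :: "nat \<Rightarrow> real"
  assumes c: "disk_coeffs c" and c0: "0 < c 0"
    and nz: "\<And>r. 0 < r \<Longrightarrow> r < 1 \<Longrightarrow> (\<Sum>n. c n * r ^ n) \<noteq> 0"
    and r: "0 < r" "r < 1"
  shows "0 < (\<Sum>n. c n * r ^ n)"
proof (rule ccontr)
  assume "\<not> ?thesis"
  hence neg: "(\<Sum>n. c n * r ^ n) \<le> 0" by simp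
  have "isCont (\<lambda>x. \<Sum>n. c n * x ^ n) x" if "0 \<le> x \<and> x \<le> r" for x
  proof (rule DERIV_isCont, rule termdiffs_strong'[where K = 1])
    show "summable (\<lambda>n. c n * z ^ n)" if "norm z < 1" for z
      using disk_coeffs_summable_real[OF c] that by simp
    show "norm x < 1" using that r by simp
  qed
  moreover have at0: "(\<Sum>n. c n * 0 ^ n) = c 0" by (rule powser_zero)
  ultimately obtain x where x: "0 \<le> x" "x \<le> r" "(\<Sum>n. c n * x ^ n) = 0"
    using IVT2[of "\<lambda>x. \<Sum>n. c n * x ^ n" r 0 0] neg c0 r by auto
  thus False using nz[of x] at0 c0 r by (cases "x = 0") auto
qed

section \<open>Harmonic functions in canonical form\<close>

lemma harmonic_has_derivative:
  assumes "(h has_field_derivative h') (at z)" "(g has_field_derivative g') (at z)"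
    and "z \<in> unit_disk" "\<And>w. w \<in> unit_disk \<Longrightarrow> f w = h w + cnj (g w)"
  shows "(f has_derivative (\<lambda>x. h' * x + cnj (g' * x))) (at z)"
proof -
  have "((\<lambda>w. h w + cnj (g w)) has_derivative (\<lambda>x. h' * x + cnj (g' * x))) (at z)"
    using assms(1,2) unfolding has_field_derivative_def
    by (intro has_derivative_add has_derivative_cnj)
  thus ?thesis
    by (rule has_derivative_transform_within_open[where s = unit_disk]) (use assms in auto)
qed

lemma wirtinger_harmonic:
  assumes "(h has_field_derivative h') (at z)" "(g has_field_derivative g') (at z)"
    and "z \<in> unit_disk" "\<And>w. w \<in> unit_disk \<Longrightarrow> f w = h w + cnj (g w)"
  shows "wirtinger f z = h'" "wirtinger_bar f z = cnj g'"
proof -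
  have "frechet_derivative f (at z) = (\<lambda>x. h' * x + cnj (g' * x))"
    using frechet_derivative_at[OF harmonic_has_derivative[OF assms]] by simp
  thus "wirtinger f z = h'" "wirtinger_bar f z = cnj g'"
    by (simp_all add: wirtinger_def wirtinger_bar_def algebra_simps)
qed

lemma eq_on_unit_disk_if_deriv_eq:
  assumes p: "\<And>w. w \<in> unit_disk \<Longrightarrow> (p has_field_derivative p' w) (at w)"
    and q: "\<And>w. w \<in> unit_disk \<Longrightarrow> (q has_field_derivative q' w) (at w)"
    and eq: "\<And>w. w \<in> unit_disk \<Longrightarrow> p' w = q' w" and "p 0 = q 0" "z \<in> unit_disk"
  shows "p z = q z"
proof -
  have "((\<lambda>w. p w - q w) has_field_derivative 0) (at w within unit_disk)"
    if w: "w \<in> unit_disk" for w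
    using has_field_derivative_at_within[OF DERIV_diff[OF p[OF w] q[OF w]]] eq[OF w] by simp
  then obtain C where "\<And>w. w \<in> unit_disk \<Longrightarrow> p w - q w = C"
    using has_field_derivative_zero_constant[of unit_disk "\<lambda>w. p w - q w"] by auto
  from this[of z] this[of 0] show ?thesis using assms(4,5) by simp
qed

text \<open>Both decompositions give the same Wirtinger derivatives of \<open>f\<close>, which are the complex derivatives of
  the parts; the normalization at \<open>0\<close> fixes the constants. Thus the condition that
  some pair of parts satisfies in the definition of the class becomes one on the explicit
  power series.\<close>

lemma harmonic_parts_unique:
  assumes hg: "harmonic_parts f h g" and hg': "harmonic_parts f h' g'" and z: "z \<in> unit_disk"
  shows "h z = h' z" "g z = g' z"
proof -
  have d: "(h has_field_derivative deriv h w) (at w)" "(g has_field_derivative deriv g w) (at w)"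
    "(h' has_field_derivative deriv h' w) (at w)" "(g' has_field_derivative deriv g' w) (at w)"
    if "w \<in> unit_disk" for w
    using hg hg' that unfolding harmonic_parts_def
    by (auto intro!: holomorphic_derivI[where S = unit_disk])
  have "wirtinger f w = deriv h w" "wirtinger_bar f w = cnj (deriv g w)" 
    "wirtinger f w = deriv h' w" "wirtinger_bar f w = cnj (deriv g' w)" if w: "w \<in> unit_disk" for w
    using wirtinger_harmonic[OF d(1,2)[OF w] w, of f] wirtinger_harmonic[OF d(3,4)[OF w] w, of f]
      hg hg' unfolding harmonic_parts_def by auto
  hence eq: "deriv h w = deriv h' w" "deriv g w = deriv g' w" if "w \<in> unit_disk" for w
    using that by (metis complex_cnj_cnj)+
  have zero: "h 0 = 0" "g 0 = 0" "h' 0 = 0" "g' 0 = 0"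
    using hg hg' by (auto simp: harmonic_parts_def)
  show "h z = h' z"
    using eq_on_unit_disk_if_deriv_eq[OF d(1) d(3) eq(1)] zero z by simp
  show "g z = g' z"
    using eq_on_unit_disk_if_deriv_eq[OF d(2) d(4) eq(2)] zero z by simp
qed

text \<open>With \<open>W = (p - q) / (p + q)\<close> one has \<open>Re W |p + q|\<^sup>2 = |p|\<^sup>2 - |q|\<^sup>2\<close> and
  \<open>|W - 1| |p + q| = 2 |q|\<close>. After \<open>|p + q| \<le> |p| + |q|\<close> a common factor \<open>|p| + |q|\<close>
  cancels, and the hypothesis is what remains.\<close>

lemma Re_quotient_ge:
  fixes p q :: complex
  assumes "0 \<le> \<alpha>" "0 \<le> k" "p + q \<noteq> 0"
    and le: "(1 + \<alpha> + 2 * k) * norm q \<le> (1 - \<alpha>) * norm p"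
  shows "\<alpha> \<le> Re ((p - q) / (p + q)) - k * norm ((p - q) / (p + q) - 1)"
proof -
  define D where "D = p + q"
  have D: "0 < norm D" using assms by (simp add: D_def)
  have "Re ((p - q) / D) = Re ((p - q) * cnj D) / (norm D)\<^sup>2"
    by (simp add: complex_div_cnj[of "p - q" D])
  also have "Re ((p - q) * cnj D) = (norm p)\<^sup>2 - (norm q)\<^sup>2"
    unfolding D_def cmod_power2 by (simp add: algebra_simps power2_eq_square)
  finally have re: "Re ((p - q) / D) = ((norm p)\<^sup>2 - (norm q)\<^sup>2) / (norm D)\<^sup>2" .
  have "(p - q) / D - 1 = - 2 * q / D" using D by (simp add: D_def field_simps)
  hence im: "norm ((p - q) / D - 1) = 2 * norm q / norm D"
    by (simp add: norm_divide norm_mult)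
  have tri: "norm D \<le> norm p + norm q" by (simp add: D_def norm_triangle_ineq)
  have "\<alpha> * (norm D)\<^sup>2 + k * (2 * norm q) * norm D = norm D * (\<alpha> * norm D + 2 * k * norm q)"
    by (simp add: power2_eq_square algebra_simps)
  also have "\<dots> \<le> (norm p + norm q) * (\<alpha> * (norm p + norm q) + 2 * k * norm q)"
    using tri assms by (intro mult_mono add_mono mult_left_mono) auto
  also have "\<dots> \<le> (norm p + norm q) * (norm p - norm q)"
    using le by (intro mult_left_mono) (auto simp: algebra_simps)
  also have "\<dots> = (norm p)\<^sup>2 - (norm q)\<^sup>2" by (simp add: power2_eq_square algebra_simps)
  finally have "\<alpha> * (norm D)\<^sup>2 \<le> (norm p)\<^sup>2 - (norm q)\<^sup>2 - k * (2 * norm q) * norm D" by simp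
  hence "\<alpha> \<le> ((norm p)\<^sup>2 - (norm q)\<^sup>2 - k * (2 * norm q) * norm D) / (norm D)\<^sup>2"
    using D by (simp add: field_simps)
  also have "\<dots> = Re ((p - q) / D) - k * norm ((p - q) / D - 1)"
    unfolding re im using D by (simp add: field_simps power2_eq_square)
  finally show ?thesis by (simp add: D_def)
qed


text \<open>The expression equals \<open>W + k e\<^sup>i\<^sup>\<phi> (W - 1)\<close>, whose real part is smallest when the rotation
  turns \<open>W - 1\<close> to the negative real axis.\<close>

lemma Re_rotation_ge:
  fixes W :: complex
  assumes "\<alpha> \<le> Re W - k * norm (W - 1)" "0 \<le> k"
  shows "\<alpha> \<le> Re ((1 + of_real k * exp (\<i> * of_real \<phi>)) * W - of_real k * exp (\<i> * of_real \<phi>))"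
proof -
  have "(1 + of_real k * exp (\<i> * of_real \<phi>)) * W - of_real k * exp (\<i> * of_real \<phi>)
      = W + of_real k * (exp (\<i> * of_real \<phi>) * (W - 1))" by (simp add: algebra_simps)
  moreover have "- norm (exp (\<i> * of_real \<phi>) * (W - 1)) \<le> Re (exp (\<i> * of_real \<phi>) * (W - 1))"
    using abs_Re_le_cmod[of "exp (\<i> * of_real \<phi>) * (W - 1)"] by linarith
  hence "k * - norm (W - 1) \<le> k * Re (exp (\<i> * of_real \<phi>) * (W - 1))"
    using assms by (intro mult_left_mono) (auto simp: norm_mult)
  ultimately show ?thesis using assms by simp
qed

section \<open>Negative coefficients\<close>

text \<open>The weights of the coefficient inequality: the sign \<open>s\<close> is \<open>1\<close> for the powers of \<open>z\<close> and
  \<open>(-1) ^ (u + v)\<close> for the conjugate powers.\<close>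

definition coefficient_weight :: "real \<Rightarrow> real \<Rightarrow> real \<Rightarrow> nat \<Rightarrow> nat \<Rightarrow> real \<Rightarrow> nat \<Rightarrow> real" where
  "coefficient_weight k \<alpha> lam u v s n =
     (1 + k) * (1 + real n * lam) ^ u - s * ((k + \<alpha>) * (1 + real n * lam) ^ v)"

lemma coefficient_weight_ge:
  assumes "0 \<le> lam" "0 \<le> \<alpha>" "\<alpha> < 1" "0 \<le> k" "v < u" "s = 1 \<or> s = -1"
  shows "(1 - \<alpha>) * (1 + real n * lam) ^ v \<le> coefficient_weight k \<alpha> lam u v s n"
proof -
  have v: "0 \<le> (1 + real n * lam) ^ v" using assms by simp
  have "(1 + real n * lam) ^ v \<le> (1 + real n * lam) ^ u"
    using assms by (intro power_increasing) auto
  hence "(1 + k) * (1 + real n * lam) ^ v \<le> (1 + k) * (1 + real n * lam) ^ u"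
    using assms by (intro mult_left_mono) auto
  moreover have "s * ((k + \<alpha>) * (1 + real n * lam) ^ v) \<le> (k + \<alpha>) * (1 + real n * lam) ^ v"
    using assms v by auto
  ultimately show ?thesis unfolding coefficient_weight_def by (simp add: algebra_simps)
qed

lemma coefficient_weight_nonneg:
  assumes "0 \<le> lam" "0 \<le> \<alpha>" "\<alpha> < 1" "0 \<le> k" "v < u" "s = 1 \<or> s = -1"
  shows "0 \<le> coefficient_weight k \<alpha> lam u v s n"
proof -
  have "0 \<le> (1 - \<alpha>) * (1 + real n * lam) ^ v" using assms by simp
  thus ?thesis using coefficient_weight_ge[OF assms, of n] by linarith
qed

lemma sign_cases: "(-1) ^ n = (1 :: real) \<or> (-1) ^ n = (-1 :: real)"
  by (cases "even n") auto

text \<open>The data of a function with negative coefficients. The index is shifted by one, so \<open>A 0 = 0\<close>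
  leaves the coefficient of \<open>z\<close> in the analytic part equal to \<open>1\<close>.\<close>

locale neg_coeffs =
  fixes u :: nat and A B :: "nat \<Rightarrow> real"
  assumes u: "1 \<le> u" and A_nonneg: "0 \<le> A n" and B_nonneg: "0 \<le> B n" and A_0: "A 0 = 0"
    and A: "disk_coeffs A" and B: "disk_coeffs B"
begin

definition analytic_part :: "complex \<Rightarrow> complex" where
  "analytic_part = shifted_sum (\<lambda>n. of_bool (n = 0) - A n)"

definition coanalytic_part :: "complex \<Rightarrow> complex" where
  "coanalytic_part = shifted_sum (\<lambda>n. (-1) ^ (u - 1) * B n)"

definition neg_map :: "complex \<Rightarrow> complex" where
  "neg_map z = analytic_part z + cnj (coanalytic_part z)"

lemmas coeffs = disk_coeffs_add disk_coeffs_diff disk_coeffs_cmult disk_coeffs_one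
  disk_coeffs_weight disk_coeffs_affine_weight[where lam = 1, simplified] A B

lemma harmonic_parts_neg_map:
  assumes f: "\<And>z. z \<in> unit_disk \<Longrightarrow> f z = neg_map z"
  shows "harmonic_parts f analytic_part coanalytic_part"
  unfolding harmonic_parts_def using f
  by (auto simp: neg_map_def analytic_part_def coanalytic_part_def
      intro!: shifted_sum_holomorphic coeffs)

lemma neg_map_eq:
  assumes z: "norm z < 1"
  shows "neg_map z = z - shifted_sum A z + (-1) ^ (u - 1) * cnj (shifted_sum B z)"
  unfolding neg_map_def analytic_part_def coanalytic_part_def shifted_sum_def using z
  by (simp add: power_sum_diff power_sum_cmult coeffs power_sum_one right_diff_distrib)

lemma wirtinger_neg_map:
  assumes f: "\<And>z. z \<in> unit_disk \<Longrightarrow> f z = neg_map z" and z: "norm z < 1"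
  shows "f differentiable (at z)"
    and "wirtinger f z = 1 - power_sum (\<lambda>n. (1 + real n) * A n) z"
    and "norm (wirtinger_bar f z) = norm (power_sum (\<lambda>n. (1 + real n) * B n) z)"
proof -
  have a: "(analytic_part has_field_derivative
      power_sum (\<lambda>n. (1 + real n) * (of_bool (n = 0) - A n)) z) (at z)"
    unfolding analytic_part_def by (intro shifted_sum_deriv coeffs z)
  have b: "(coanalytic_part has_field_derivative
      power_sum (\<lambda>n. (1 + real n) * ((-1) ^ (u - 1) * B n)) z) (at z)"
    unfolding coanalytic_part_def by (intro shifted_sum_deriv coeffs z)
  have *: "z \<in> unit_disk" "\<And>w. w \<in> unit_disk \<Longrightarrow> f w = analytic_part w + cnj (coanalytic_part w)"
    using f z by (auto simp: neg_map_def)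
  show "f differentiable (at z)"
    using harmonic_has_derivative[OF a b *] unfolding differentiable_def by blast
  have "power_sum (\<lambda>n. (1 + real n) * (of_bool (n = 0) - A n)) z
      = power_sum (\<lambda>n. of_bool (n = 0) - (1 + real n) * A n) z"
    unfolding power_sum_def by (intro suminf_cong) auto
  also have "\<dots> = 1 - power_sum (\<lambda>n. (1 + real n) * A n) z"
    using z by (simp add: power_sum_diff power_sum_one coeffs)
  finally show "wirtinger f z = 1 - power_sum (\<lambda>n. (1 + real n) * A n) z"
    using wirtinger_harmonic(1)[OF a b *] by simp
  have "power_sum (\<lambda>n. (1 + real n) * ((-1) ^ (u - 1) * B n)) z
      = power_sum (\<lambda>n. (-1) ^ (u - 1) * ((1 + real n) * B n)) z"
    by (simp add: mult_ac)
  also have "\<dots> = of_real ((-1) ^ (u - 1)) * power_sum (\<lambda>n. (1 + real n) * B n) z"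
    using z by (intro power_sum_cmult coeffs)
  finally show "norm (wirtinger_bar f z) = norm (power_sum (\<lambda>n. (1 + real n) * B n) z)"
    using wirtinger_harmonic(2)[OF a b *] by (simp add: norm_mult norm_power)
qed

text \<open>The sign \<open>(-1) ^ (u - 1)\<close> of the class meets \<open>(-1) ^ m\<close> from the operator. For \<open>m = u\<close> all
  coefficients become negative; for \<open>m = v\<close> the conjugate powers get the sign \<open>- s\<close>.\<close>

lemma al_oboudi_harmonic_neg_map:
  assumes f: "\<And>z. z \<in> unit_disk \<Longrightarrow> f z = neg_map z" and hg: "harmonic_parts f h g"
    and z: "norm z < 1"
  shows "al_oboudi_harmonic lam m h g z =
    z - shifted_sum (\<lambda>n. (1 + real n * lam) ^ m * A n) z
      - (-1) ^ (u + m) * shifted_sum (\<lambda>n. (1 + real n * lam) ^ m * B n) (cnj z)"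
proof -
  note eq = harmonic_parts_unique[OF hg harmonic_parts_neg_map[OF f]]
  have "al_oboudi lam m h z =
      shifted_sum (\<lambda>n. (1 + real n * lam) ^ m * (of_bool (n = 0) - A n)) z"
    using eq z by (intro al_oboudi_shifted_sum coeffs) (auto simp: analytic_part_def)
  also have "(\<lambda>n. (1 + real n * lam) ^ m * (of_bool (n = 0) - A n))
      = (\<lambda>n. of_bool (n = 0) - (1 + real n * lam) ^ m * A n)" by auto
  also have "shifted_sum \<dots> z = z - shifted_sum (\<lambda>n. (1 + real n * lam) ^ m * A n) z"
    unfolding shifted_sum_def using z
    by (simp add: power_sum_diff power_sum_one coeffs right_diff_distrib)
  finally have 1: "al_oboudi lam m h z = \<dots>" .
  have "al_oboudi lam m g z =
      shifted_sum (\<lambda>n. (1 + real n * lam) ^ m * ((-1) ^ (u - 1) * B n)) z"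
    using eq z by (intro al_oboudi_shifted_sum coeffs) (auto simp: coanalytic_part_def)
  also have "(\<lambda>n. (1 + real n * lam) ^ m * ((-1) ^ (u - 1) * B n))
      = (\<lambda>n. (-1) ^ (u - 1) * ((1 + real n * lam) ^ m * B n))" by (simp add: mult_ac)
  also have "shifted_sum \<dots> z
      = (-1) ^ (u - 1) * shifted_sum (\<lambda>n. (1 + real n * lam) ^ m * B n) z"
    unfolding shifted_sum_def using z by (simp add: power_sum_cmult coeffs)
  finally have 2: "cnj (al_oboudi lam m g z)
      = (-1) ^ (u - 1) * shifted_sum (\<lambda>n. (1 + real n * lam) ^ m * B n) (cnj z)"
    using z by (simp add: shifted_sum_def cnj_power_sum coeffs)
  have "(-1) ^ m * (-1) ^ (u - 1) = - ((-1) ^ (u + m) :: complex)"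
    using u by (cases u) (auto simp: power_add)
  thus ?thesis unfolding al_oboudi_harmonic_def 1 2
    by (simp flip: mult.assoc)
qed

text \<open>On the real axis the two Wirtinger derivatives are real up to a sign, and a positive Jacobian
  compares their moduli. The analytic one starts at \<open>1\<close> and never vanishes, so its modulus can be
  removed.\<close>

lemma partial_sums_le_if_SH:
  assumes f: "\<And>z. z \<in> unit_disk \<Longrightarrow> f z = neg_map z" and SH: "f \<in> SH"
  shows "(\<Sum>n<N. (1 + real n) * (A n + B n)) \<le> 1"
proof (rule partial_sums_le_if_Abel_sums_le)
  show "0 \<le> (1 + real n) * (A n + B n)" for n using A_nonneg B_nonneg by simp
  show "disk_coeffs (\<lambda>n. (1 + real n) * (A n + B n))" by (intro coeffs)
  let ?d = "\<lambda>n. of_bool (n = 0) - (1 + real n) * A n"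
  let ?e = "\<lambda>n. (1 + real n) * B n"
  \<comment> \<open>The series \<open>?d\<close> and, up to sign, \<open>?e\<close> are the Wirtinger derivatives at \<open>r\<close>.\<close>
  have jac: "\<bar>\<Sum>n. ?e n * r ^ n\<bar> < \<bar>\<Sum>n. ?d n * r ^ n\<bar>" if r: "0 \<le> r" "r < 1" for r
  proof -
    have z: "norm (complex_of_real r) < 1" using r by simp
    have "(norm (wirtinger_bar f (of_real r)))\<^sup>2 < (norm (wirtinger f (of_real r)))\<^sup>2"
      using SH z unfolding SH_def sense_preserving_on_def by auto
    hence "norm (wirtinger_bar f (of_real r)) < norm (wirtinger f (of_real r))"
      by (rule power2_less_imp_less) simp
    moreover have "wirtinger f (of_real r) = power_sum ?d (of_real r)"
      using wirtinger_neg_map(2)[OF f z] z by (simp add: power_sum_diff power_sum_one coeffs)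
    moreover have "power_sum ?d (of_real r) = of_real (\<Sum>n. ?d n * r ^ n)"
      using r by (intro power_sum_of_real coeffs) auto
    moreover have "power_sum ?e (of_real r) = of_real (\<Sum>n. ?e n * r ^ n)"
      using r by (intro power_sum_of_real coeffs) auto
    ultimately show ?thesis using wirtinger_neg_map(3)[OF f z] by simp
  qed
  fix r :: real assume r: "0 < r" "r < 1"
  have pos: "0 < (\<Sum>n. ?d n * r ^ n)"
  proof (rule power_series_positive[OF _ _ _ r])
    show "disk_coeffs ?d" by (intro coeffs)
    show "0 < ?d 0" by (simp add: A_0)
    show "(\<Sum>n. ?d n * r ^ n) \<noteq> 0" if "0 < r" "r < 1" for r using jac[of r] that by auto
  qed
  have s: "summable (\<lambda>n. ?d n * r ^ n)" "summable (\<lambda>n. ?e n * r ^ n)"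
    "summable (\<lambda>n. of_bool (n = 0) * r ^ n)"
    using r by (intro disk_coeffs_summable_real coeffs; simp)+
  have "(\<Sum>n. (1 + real n) * (A n + B n) * r ^ n)
      = (\<Sum>n. of_bool (n = 0) * r ^ n - ?d n * r ^ n + ?e n * r ^ n)"
    by (intro suminf_cong) (simp add: algebra_simps)
  also have "\<dots> = (\<Sum>n. of_bool (n = 0) * r ^ n) - (\<Sum>n. ?d n * r ^ n) + (\<Sum>n. ?e n * r ^ n)"
    using s by (simp add: suminf_add[symmetric] suminf_diff[symmetric] summable_diff)
  also have "(\<Sum>n. of_bool (n = 0) * r ^ n) = 1" by (rule suminf_power_one)
  finally show "(\<Sum>n. (1 + real n) * (A n + B n) * r ^ n) \<le> 1"
    using jac[of r] pos r by auto
qed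

text \<open>At a point \<open>r > 0\<close> and for \<open>\<phi> = 0\<close> the defining condition reads
  \<open>(1 + k) D\<^sup>u f / D\<^sup>v f \<ge> k + \<alpha>\<close> with real \<open>D\<^sup>u f\<close> and \<open>D\<^sup>v f\<close>. Since
  \<open>D\<^sup>v f\<close> is positive near \<open>0\<close> and has no zero, it can be cleared, and the coefficients of
  \<open>(1 + k) D\<^sup>u f - (k + \<alpha>) D\<^sup>v f\<close> are those of the claim.\<close>

lemma partial_sums_le_if_kUSH:
  assumes par: "0 \<le> lam" "0 \<le> \<alpha>" "\<alpha> < 1" "0 \<le> k" "v < u" and B0: "B 0 < 1"
    and f: "\<And>z. z \<in> unit_disk \<Longrightarrow> f z = neg_map z" and kUSH: "f \<in> kUSH k u v \<alpha> lam"
  shows "(\<Sum>n<N. coefficient_weight k \<alpha> lam u v 1 n * A n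
      + coefficient_weight k \<alpha> lam u v ((-1) ^ (u + v)) n * B n) \<le> 1 - \<alpha>"
    (is "(\<Sum>n<N. ?c n) \<le> _")
proof (rule partial_sums_le_if_Abel_sums_le)
  define s :: real where "s = (-1) ^ (u + v)"
  have s: "s = 1 \<or> s = -1" unfolding s_def by (rule sign_cases)
  note wt = coefficient_weight_nonneg[OF par]
  show "0 \<le> ?c n" for n
    using wt[of 1 n] wt[OF s, of n] A_nonneg[of n] B_nonneg[of n] by (simp add: s_def)
  have c: "?c n = (1 + k) * ((1 + real n * lam) ^ u * A n) - (k + \<alpha>) * ((1 + real n * lam) ^ v * A n)
      + ((1 + k) * ((1 + real n * lam) ^ u * B n) - (s * (k + \<alpha>)) * ((1 + real n * lam) ^ v * B n))"
    for n by (simp add: coefficient_weight_def s_def algebra_simps)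
  show "disk_coeffs ?c" unfolding c by (intro coeffs)
  from kUSH obtain h g where hg: "harmonic_parts f h g"
    and nz: "\<And>z. z \<in> unit_disk - {0} \<Longrightarrow> al_oboudi_harmonic lam v h g z \<noteq> 0"
    and re: "\<And>z \<phi>. z \<in> unit_disk - {0} \<Longrightarrow> Re ((1 + of_real k * exp (\<i> * of_real \<phi>)) *
                 (al_oboudi_harmonic lam u h g z / al_oboudi_harmonic lam v h g z)
               - of_real k * exp (\<i> * of_real \<phi>)) \<ge> \<alpha>"
    unfolding kUSH_def by blast
  \<comment> \<open>The coefficients of \<open>D\<^sup>m f / r\<close> on the real axis.\<close>
  define y where "y = (\<lambda>m n. of_bool (n = 0) - (1 + real n * lam) ^ m * A n
      - (-1) ^ (u + m) * ((1 + real n * lam) ^ m * B n))"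
  have y: "disk_coeffs (y m)" for m unfolding y_def by (intro coeffs)
  have D: "al_oboudi_harmonic lam m h g (of_real r) = of_real (r * (\<Sum>n. y m n * r ^ n))"
    if r: "0 < r" "r < 1" for m r
  proof -
    have z: "norm (complex_of_real r) < 1" using r by simp
    have "al_oboudi_harmonic lam m h g (of_real r) = of_real r * power_sum (y m) (of_real r)"
      using al_oboudi_harmonic_neg_map[OF f hg z, of lam m] z
      by (simp add: y_def shifted_sum_def power_sum_diff power_sum_cmult power_sum_one coeffs right_diff_distrib)
    also have "power_sum (y m) (of_real r) = of_real (\<Sum>n. y m n * r ^ n)"
      using r by (intro power_sum_of_real y) auto
    finally show ?thesis by simp
  qed
  fix r :: real assume r: "0 < r" "r < 1"
  have pos: "0 < (\<Sum>n. y v n * r ^ n)"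
  proof (rule power_series_positive[OF y _ _ r])
    show "0 < y v 0" using B0 B_nonneg[of 0] s
      by (auto simp: y_def A_0 s_def)
    show "(\<Sum>n. y v n * r ^ n) \<noteq> 0" if "0 < r" "r < 1" for r
      using nz[of "of_real r"] D[OF that, of v] that by auto
  qed
  have "\<alpha> \<le> (1 + k) * ((\<Sum>n. y u n * r ^ n) / (\<Sum>n. y v n * r ^ n)) - k"
    using re[of "of_real r" 0] D[OF r] r
    by (simp flip: of_real_divide of_real_mult of_real_add of_real_diff)
  hence "(k + \<alpha>) * (\<Sum>n. y v n * r ^ n) \<le> (1 + k) * (\<Sum>n. y u n * r ^ n)"
    using pos by (simp add: field_simps)
  moreover have "(\<Sum>n. ?c n * r ^ n) = (1 - \<alpha>) - (1 + k) * (\<Sum>n. y u n * r ^ n)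
      + (k + \<alpha>) * (\<Sum>n. y v n * r ^ n)"
  proof -
    have sm: "summable (\<lambda>n. y m n * r ^ n)" for m
      using r by (intro disk_coeffs_summable_real y) auto
    have "(\<lambda>n. (1 - \<alpha>) * (of_bool (n = 0) * r ^ n) - (1 + k) * (y u n * r ^ n)
          + (k + \<alpha>) * (y v n * r ^ n)) sums ((1 - \<alpha>) * (\<Sum>n. of_bool (n = 0) * r ^ n)
          - (1 + k) * (\<Sum>n. y u n * r ^ n) + (k + \<alpha>) * (\<Sum>n. y v n * r ^ n))"
      by (intro sums_add sums_diff sums_mult summable_sums sm
          disk_coeffs_summable_real[OF disk_coeffs_one]) (use r in auto)
    moreover have "(1 - \<alpha>) * (of_bool (n = 0) * r ^ n) - (1 + k) * (y u n * r ^ n)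
          + (k + \<alpha>) * (y v n * r ^ n) = ?c n * r ^ n" for n
      unfolding c y_def s_def by (simp add: algebra_simps)
    ultimately show ?thesis using suminf_power_one[of r] by (simp add: sums_iff)
  qed
  ultimately show "(\<Sum>n. ?c n * r ^ n) \<le> 1 - \<alpha>" by simp
qed


text \<open>For \<open>|z|, |w| \<le> r < 1\<close> the perturbation of the identity has a Lipschitz constant at most
  \<open>\<Sum>(n + 1)(A n + B n) r\<^sup>n\<close>. It is less than \<open>1\<close>, because \<open>B 0 < 1\<close> excludes that the
  whole mass sits in the constant term.\<close>

lemma neg_map_in_SH:
  assumes f: "\<And>z. z \<in> unit_disk \<Longrightarrow> f z = neg_map z"
    and B0: "B 0 < 1" and le: "\<And>N. (\<Sum>n<N. (1 + real n) * (A n + B n)) \<le> 1"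
  shows "f \<in> SH"
proof -
  let ?a = "\<lambda>n. (1 + real n) * A n" and ?b = "\<lambda>n. (1 + real n) * B n"
  have dc: "disk_coeffs ?a" "disk_coeffs ?b" by (intro coeffs)+
  have less: "(\<Sum>n. ?a n * r ^ n) + (\<Sum>n. ?b n * r ^ n) < 1" if r: "0 \<le> r" "r < 1" for r
  proof -
    have "(\<Sum>n. (?a n + ?b n) * r ^ n) < 1"
      using le B0 A_0 A_nonneg B_nonneg r
      by (intro Abel_sum_less_1) (auto simp: distrib_left intro!: add_nonneg_nonneg)
    thus ?thesis using suminf_power_add[of ?a ?b r] dc r by simp
  qed
  have bound: "norm (power_sum ?a z) \<le> (\<Sum>n. ?a n * r ^ n)"
      "norm (power_sum ?b z) \<le> (\<Sum>n. ?b n * r ^ n)" if "norm z \<le> r" "r < 1" for z r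
    using A_nonneg B_nonneg that by (intro norm_power_sum_le dc; simp)+
  have "inj_on f unit_disk"
  proof (rule inj_onI)
    fix z w assume zw: "z \<in> unit_disk" "w \<in> unit_disk" "f z = f w"
    define r where "r = max (norm z) (norm w)"
    have r: "0 \<le> r" "r < 1" "norm z \<le> r" "norm w \<le> r" using zw by (auto simp: r_def le_max_iff_disj)
    have lip: "norm (shifted_sum c z - shifted_sum c w) \<le> K * norm (z - w)"
      if "disk_coeffs c" "\<And>z. norm z \<le> r \<Longrightarrow> norm (power_sum (\<lambda>n. (1 + real n) * c n) z) \<le> K"
      for c K
    proof (rule field_differentiable_bound[of "cball 0 r"])
      fix x :: complex assume x: "x \<in> cball 0 r"
      show "(shifted_sum c has_field_derivative power_sum (\<lambda>n. (1 + real n) * c n) x)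
          (at x within cball 0 r)"
        using x r by (intro shifted_sum_deriv that) auto
      show "norm (power_sum (\<lambda>n. (1 + real n) * c n) x) \<le> K" using that x by auto
    qed (use r in auto)
    let ?K = "\<Sum>n. ?a n * r ^ n" and ?L = "\<Sum>n. ?b n * r ^ n"
    have eq: "z - w = (shifted_sum A z - shifted_sum A w)
        - (-1) ^ (u - 1) * cnj (shifted_sum B z - shifted_sum B w)"
    proof -
      have "neg_map z = neg_map w" using zw f by metis
      hence "z - shifted_sum A z + (-1) ^ (u - 1) * cnj (shifted_sum B z) =
          w - shifted_sum A w + (-1) ^ (u - 1) * cnj (shifted_sum B w)"
        using zw by (simp add: neg_map_eq)
      thus ?thesis by (simp add: right_diff_distrib algebra_simps)
    qed
    have "norm (z - w) \<le> norm (shifted_sum A z - shifted_sum A w)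
        + norm ((-1) ^ (u - 1) * cnj (shifted_sum B z - shifted_sum B w))"
      by (subst eq) (rule norm_triangle_ineq4)
    also have "norm ((-1) ^ (u - 1) * cnj (shifted_sum B z - shifted_sum B w))
        = norm (shifted_sum B z - shifted_sum B w)"
      by (simp only: norm_mult norm_power complex_mod_cnj) simp
    also have "norm (shifted_sum A z - shifted_sum A w) \<le> ?K * norm (z - w)"
      using bound(1) r A by (intro lip) auto
    also have "norm (shifted_sum B z - shifted_sum B w) \<le> ?L * norm (z - w)"
      using bound(2) r B by (intro lip) auto
    finally have "(1 - (?K + ?L)) * norm (z - w) \<le> 0" by (simp add: algebra_simps)
    moreover have "0 < 1 - (?K + ?L)" using less[of r] r by simp
    ultimately show "z = w" by (simp add: mult_le_0_iff)
  qed
  moreover have "sense_preserving_on f unit_disk"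
    unfolding sense_preserving_on_def
  proof (intro ballI conjI)
    fix z :: complex assume "z \<in> unit_disk"
    hence z: "norm z < 1" by simp
    show "f differentiable (at z)" by (rule wirtinger_neg_map(1)[OF f z])
    have "norm (wirtinger_bar f z) \<le> (\<Sum>n. ?b n * norm z ^ n)"
      using wirtinger_neg_map(3)[OF f z] bound(2)[of z "norm z"] z by simp
    also have "\<dots> < 1 - (\<Sum>n. ?a n * norm z ^ n)" using less[of "norm z"] z by simp
    also have "\<dots> \<le> norm (1 - power_sum ?a z)"
      using bound(1)[of z "norm z"] z norm_triangle_ineq2[of 1 "power_sum ?a z"] by simp
    also have "\<dots> = norm (wirtinger f z)" using wirtinger_neg_map(2)[OF f z] by simp
    finally have "(norm (wirtinger_bar f z))\<^sup>2 < (norm (wirtinger f z))\<^sup>2"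
      by (intro power_strict_mono) auto
    thus "(norm (wirtinger f z))\<^sup>2 - (norm (wirtinger_bar f z))\<^sup>2 > 0" by simp
  qed
  moreover have "f 0 = 0"
    using f[of 0] by (simp add: neg_map_def analytic_part_def coanalytic_part_def)
  moreover have "wirtinger f 0 = 1"
    using wirtinger_neg_map(2)[OF f, of 0] by (simp add: power_sum_def powser_zero A_0)
  ultimately show ?thesis
    using harmonic_parts_neg_map[OF f] unfolding SH_def by blast
qed

text \<open>At a zero \<open>z\<close> is equal to the rest of the series, which is smaller in modulus.\<close>

lemma al_oboudi_harmonic_nonzero:
  assumes lam: "0 \<le> lam" and B0: "B 0 < 1"
    and f: "\<And>z. z \<in> unit_disk \<Longrightarrow> f z = neg_map z" and hg: "harmonic_parts f h g"
    and le: "\<And>N. (\<Sum>n<N. (1 + real n * lam) ^ m * (A n + B n)) \<le> 1"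
    and z: "norm z < 1" "z \<noteq> 0"
  shows "al_oboudi_harmonic lam m h g z \<noteq> 0"
proof
  let ?A = "\<lambda>n. (1 + real n * lam) ^ m * A n" and ?B = "\<lambda>n. (1 + real n * lam) ^ m * B n"
  have w0: "0 \<le> (1 + real n * lam) ^ m" for n using lam by simp
  assume "al_oboudi_harmonic lam m h g z = 0"
  hence "z = shifted_sum ?A z + (-1) ^ (u + m) * shifted_sum ?B (cnj z)"
    using al_oboudi_harmonic_neg_map[OF f hg z(1), of lam m] by (simp add: algebra_simps)
  hence "norm z = norm (shifted_sum ?A z + (-1) ^ (u + m) * shifted_sum ?B (cnj z))"
    by (rule arg_cong)
  also have "\<dots> \<le> norm (shifted_sum ?A z) + norm ((-1) ^ (u + m) * shifted_sum ?B (cnj z))"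
    by (rule norm_triangle_ineq)
  also have "\<dots> = norm z * (norm (power_sum ?A z) + norm (power_sum ?B (cnj z)))"
    by (simp add: shifted_sum_def norm_mult norm_power distrib_left)
  finally have "norm z * 1 \<le> norm z * (norm (power_sum ?A z) + norm (power_sum ?B (cnj z)))"
    by simp
  hence "1 \<le> norm (power_sum ?A z) + norm (power_sum ?B (cnj z))"
    by (rule mult_left_le_imp_le) (use z in simp)
  also have "\<dots> \<le> (\<Sum>n. ?A n * norm z ^ n) + (\<Sum>n. ?B n * norm z ^ n)"
    using z w0 A_nonneg B_nonneg by (intro add_mono norm_power_sum_le coeffs) auto
  also have "\<dots> = (\<Sum>n. (?A n + ?B n) * norm z ^ n)"
    using z by (intro suminf_power_add[symmetric] coeffs) auto
  also have "\<dots> < 1"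
    using z w0 A_nonneg B_nonneg A_0 B0 le by (intro Abel_sum_less_1) (auto simp: distrib_left)
  finally show False by simp
qed

text \<open>The powers of \<open>z\<close> enter \<open>z - p\<close> and \<open>q\<close> with the nonnegative coefficients
  \<open>(w\<^sup>u + w\<^sup>v) / 2\<close> and \<open>(w\<^sup>u - w\<^sup>v) / 2\<close> times \<open>A\<close>, the conjugate powers with
  \<open>(w\<^sup>u + s w\<^sup>v) / 2\<close> and \<open>(w\<^sup>u - s w\<^sup>v) / 2\<close> times \<open>B\<close>. Weighting the first
  of each pair by \<open>1 - \<alpha>\<close> and the second by \<open>1 + \<alpha> + 2 k\<close> gives exactly \<open>coefficient_weight\<close>,
  so the triangle inequality loses nothing against the hypothesis.\<close>

lemma al_oboudi_harmonic_difference_le: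
  assumes par: "0 \<le> lam" "0 \<le> \<alpha>" "\<alpha> < 1" "0 \<le> k" "v < u"
    and f: "\<And>z. z \<in> unit_disk \<Longrightarrow> f z = neg_map z" and hg: "harmonic_parts f h g"
    and le: "\<And>N. (\<Sum>n<N. coefficient_weight k \<alpha> lam u v 1 n * A n
      + coefficient_weight k \<alpha> lam u v ((-1) ^ (u + v)) n * B n) \<le> 1 - \<alpha>"
    and z: "norm z < 1"
    and p: "p = (al_oboudi_harmonic lam v h g z + al_oboudi_harmonic lam u h g z) / 2"
    and q: "q = (al_oboudi_harmonic lam v h g z - al_oboudi_harmonic lam u h g z) / 2"
  shows "(1 + \<alpha> + 2 * k) * norm q \<le> (1 - \<alpha>) * norm p"
proof -
  define s :: real where "s = (-1) ^ (u + v)"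
  have s: "s = 1 \<or> s = -1" unfolding s_def by (rule sign_cases)
  let ?w = "\<lambda>n. 1 + real n * lam"
  let ?e = "coefficient_weight k \<alpha> lam u v"
  let ?A = "\<lambda>m n. ?w n ^ m * A n" and ?B = "\<lambda>m n. ?w n ^ m * B n"
  define c where "c = (\<lambda>n. ?e 1 n * A n + ?e s n * B n)"
  have c0: "0 \<le> c n" for n
    unfolding c_def using coefficient_weight_nonneg[OF par, of 1 n]
      coefficient_weight_nonneg[OF par s, of n] A_nonneg[of n] B_nonneg[of n] by simp
  have cle: "sum c {..<N} \<le> 1 - \<alpha>" for N using le[of N] by (simp add: c_def s_def)
  have sgn: "of_real s = ((-1) ^ (u + v) :: complex)" by (simp add: s_def)
  have Du: "al_oboudi_harmonic lam u h g z = z - shifted_sum (?A u) z - shifted_sum (?B u) (cnj z)"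
    and Dv: "al_oboudi_harmonic lam v h g z
      = z - shifted_sum (?A v) z - of_real s * shifted_sum (?B v) (cnj z)"
    using al_oboudi_harmonic_neg_map[OF f hg z] sgn by auto
  define r where "r = norm z"
  have r: "0 \<le> r" "r < 1" using z by (auto simp: r_def)
  define P1 where "P1 = (\<lambda>n. (1/2) * ?A u n + (1/2) * ?A v n)"
  define P2 where "P2 = (\<lambda>n. (1/2) * ?B u n + (s/2) * ?B v n)"
  define Q1 where "Q1 = (\<lambda>n. (1/2) * ?A u n + (-1/2) * ?A v n)"
  define Q2 where "Q2 = (\<lambda>n. (1/2) * ?B u n + (-s/2) * ?B v n)"
  have dc: "disk_coeffs P1" "disk_coeffs P2" "disk_coeffs Q1" "disk_coeffs Q2"
    unfolding P1_def P2_def Q1_def Q2_def by (intro coeffs)+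
  have nonneg: "0 \<le> P1 n" "0 \<le> P2 n" "0 \<le> Q1 n" "0 \<le> Q2 n" for n
  proof -
    have "0 \<le> ?w n ^ v" "?w n ^ v \<le> ?w n ^ u" using par by (auto intro!: power_increasing)
    hence "0 \<le> ?A v n" "?A v n \<le> ?A u n" "0 \<le> ?B v n" "?B v n \<le> ?B u n"
      using A_nonneg B_nonneg by (auto intro!: mult_right_mono)
    thus "0 \<le> P1 n" "0 \<le> P2 n" "0 \<le> Q1 n" "0 \<le> Q2 n"
      using s by (auto simp: P1_def P2_def Q1_def Q2_def)
  qed
  have zc: "norm (cnj z) < 1" using z by simp
  have ps: "power_sum P1 z = of_real (1/2) * power_sum (?A u) z + of_real (1/2) * power_sum (?A v) z"
    "power_sum P2 (cnj z)
      = of_real (1/2) * power_sum (?B u) (cnj z) + of_real (s/2) * power_sum (?B v) (cnj z)"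
    "power_sum Q1 z = of_real (1/2) * power_sum (?A u) z + of_real (-1/2) * power_sum (?A v) z"
    "power_sum Q2 (cnj z)
      = of_real (1/2) * power_sum (?B u) (cnj z) + of_real (-s/2) * power_sum (?B v) (cnj z)"
    unfolding P1_def P2_def Q1_def Q2_def by (intro power_sum_linear coeffs z zc)+
  have p': "z - p = shifted_sum P1 z + shifted_sum P2 (cnj z)"
    and q': "q = shifted_sum Q1 z + shifted_sum Q2 (cnj z)"
    unfolding p q Du Dv shifted_sum_def ps by (simp_all add: field_simps)
  let ?S = "\<lambda>d. \<Sum>n. d n * r ^ n"
  have bound: "norm (shifted_sum d y) \<le> r * ?S d"
    if "disk_coeffs d" "\<And>n. 0 \<le> d n" "norm y = r" for d y
    using norm_power_sum_le[OF that(1,2), of y r] that(3) r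
    by (simp add: shifted_sum_def norm_mult mult_left_mono)
  have rz: "norm z = r" "norm (cnj z) = r" by (simp_all add: r_def)
  have "norm (z - p) \<le> r * ?S P1 + r * ?S P2"
    unfolding p' by (intro norm_triangle_mono bound dc nonneg rz)
  hence np: "(1 - \<alpha>) * norm (z - p) \<le> (1 - \<alpha>) * (r * ?S P1 + r * ?S P2)"
    using par by (intro mult_left_mono) auto
  have "norm q \<le> r * ?S Q1 + r * ?S Q2"
    unfolding q' by (intro norm_triangle_mono bound dc nonneg rz)
  hence nq: "(1 + \<alpha> + 2 * k) * norm q \<le> (1 + \<alpha> + 2 * k) * (r * ?S Q1 + r * ?S Q2)"
    using par by (intro mult_left_mono) auto
  have sm: "(\<lambda>n. d n * r ^ n) sums ?S d" if "disk_coeffs d" for d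
    using that r by (intro summable_sums disk_coeffs_summable_real) auto
  have "(\<lambda>n. (1 - \<alpha>) * (P1 n * r ^ n + P2 n * r ^ n)
      + (1 + \<alpha> + 2 * k) * (Q1 n * r ^ n + Q2 n * r ^ n)) sums
      ((1 - \<alpha>) * (?S P1 + ?S P2) + (1 + \<alpha> + 2 * k) * (?S Q1 + ?S Q2))"
    by (intro sums_add sums_mult sm dc)
  moreover have "(1 - \<alpha>) * (P1 n * r ^ n + P2 n * r ^ n)
      + (1 + \<alpha> + 2 * k) * (Q1 n * r ^ n + Q2 n * r ^ n) = c n * r ^ n" for n
  proof -
    have "(1 - \<alpha>) * P1 n + (1 + \<alpha> + 2 * k) * Q1 n = ?e 1 n * A n"
      unfolding P1_def Q1_def coefficient_weight_def by (simp add: field_simps)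
    moreover have "(1 - \<alpha>) * P2 n + (1 + \<alpha> + 2 * k) * Q2 n = ?e s n * B n"
      unfolding P2_def Q2_def coefficient_weight_def by (simp add: field_simps)
    ultimately have "c n * r ^ n = ((1 - \<alpha>) * P1 n + (1 + \<alpha> + 2 * k) * Q1 n
        + ((1 - \<alpha>) * P2 n + (1 + \<alpha> + 2 * k) * Q2 n)) * r ^ n" by (simp add: c_def)
    thus ?thesis by (simp add: algebra_simps)
  qed
  ultimately have "(1 - \<alpha>) * (?S P1 + ?S P2) + (1 + \<alpha> + 2 * k) * (?S Q1 + ?S Q2) = ?S c"
    by (simp add: sums_iff)
  also have "?S c \<le> c 0 + r * (1 - \<alpha> - c 0)" using r by (intro Abel_sum_le c0 cle) auto
  also have "\<dots> \<le> 1 - \<alpha>"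
  proof -
    have "r * (1 - \<alpha> - c 0) \<le> 1 * (1 - \<alpha> - c 0)"
      using cle[of 1] r by (intro mult_right_mono) auto
    thus ?thesis by simp
  qed
  finally have "r * ((1 - \<alpha>) * (?S P1 + ?S P2) + (1 + \<alpha> + 2 * k) * (?S Q1 + ?S Q2))
      \<le> r * (1 - \<alpha>)" using r by (intro mult_left_mono) auto
  hence "(1 - \<alpha>) * norm (z - p) + (1 + \<alpha> + 2 * k) * norm q \<le> r * (1 - \<alpha>)"
    using np nq by (simp add: algebra_simps)
  moreover have "(1 - \<alpha>) * r \<le> (1 - \<alpha>) * (norm (z - p) + norm p)"
    using par norm_triangle_ineq[of "z - p" p] by (intro mult_left_mono) (auto simp: r_def)
  ultimately show ?thesis by (simp add: algebra_simps)
qed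

lemma neg_map_in_kUSH:
  assumes par: "0 \<le> lam" "0 \<le> \<alpha>" "\<alpha> < 1" "0 \<le> k" "v < u" and B0: "B 0 < 1"
    and f: "\<And>z. z \<in> unit_disk \<Longrightarrow> f z = neg_map z" and SH: "f \<in> SH"
    and le: "\<And>N. (\<Sum>n<N. coefficient_weight k \<alpha> lam u v 1 n * A n
      + coefficient_weight k \<alpha> lam u v ((-1) ^ (u + v)) n * B n) \<le> 1 - \<alpha>"
  shows "f \<in> kUSH k u v \<alpha> lam"
proof -
  let ?D = "\<lambda>m. al_oboudi_harmonic lam m analytic_part coanalytic_part"
  have hg: "harmonic_parts f analytic_part coanalytic_part"
    using f by (rule harmonic_parts_neg_map)
  \<comment> \<open>Each weight dominates \<open>(1 - \<alpha>) w\<^sup>v\<close>, so the hypothesis also bounds the coefficients of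
    \<open>D\<^sup>v f\<close>.\<close>
  have lev: "(\<Sum>n<N. (1 + real n * lam) ^ v * (A n + B n)) \<le> 1" for N
  proof -
    have "(1 - \<alpha>) * (\<Sum>n<N. (1 + real n * lam) ^ v * (A n + B n))
        \<le> (\<Sum>n<N. coefficient_weight k \<alpha> lam u v 1 n * A n
          + coefficient_weight k \<alpha> lam u v ((-1) ^ (u + v)) n * B n)"
      unfolding sum_distrib_left
    proof (rule sum_mono)
      fix n
      have "(1 - \<alpha>) * (1 + real n * lam) ^ v * A n \<le> coefficient_weight k \<alpha> lam u v 1 n * A n"
        "(1 - \<alpha>) * (1 + real n * lam) ^ v * B n
          \<le> coefficient_weight k \<alpha> lam u v ((-1) ^ (u + v)) n * B n"
        by (intro mult_right_mono coefficient_weight_ge par sign_cases A_nonneg B_nonneg; simp)+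
      thus "(1 - \<alpha>) * ((1 + real n * lam) ^ v * (A n + B n))
          \<le> coefficient_weight k \<alpha> lam u v 1 n * A n
            + coefficient_weight k \<alpha> lam u v ((-1) ^ (u + v)) n * B n"
        by (simp add: algebra_simps)
    qed
    also have "\<dots> \<le> (1 - \<alpha>) * 1" using le by simp
    finally show ?thesis using par by simp
  qed
  have "?D v z \<noteq> 0 \<and> (\<forall>\<phi>::real. \<alpha> \<le>
      Re ((1 + of_real k * exp (\<i> * of_real \<phi>)) * (?D u z / ?D v z)
        - of_real k * exp (\<i> * of_real \<phi>)))" if "z \<in> unit_disk - {0}" for z
  proof -
    have z: "norm z < 1" "z \<noteq> 0" using that by auto
    have nz: "?D v z \<noteq> 0"
      by (rule al_oboudi_harmonic_nonzero[OF par(1) B0 f hg lev z])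
    define p where "p = (?D v z + ?D u z) / 2"
    define q where "q = (?D v z - ?D u z) / 2"
    have pq: "p + q = ?D v z" "p - q = ?D u z" by (simp_all add: p_def q_def field_simps)
    have "(1 + \<alpha> + 2 * k) * norm q \<le> (1 - \<alpha>) * norm p"
      using al_oboudi_harmonic_difference_le[OF par f hg le z(1) p_def q_def] by simp
    hence "\<alpha> \<le> Re (?D u z / ?D v z) - k * norm (?D u z / ?D v z - 1)"
      using Re_quotient_ge[OF par(2,4), of p q] nz unfolding pq by simp
    from Re_rotation_ge[OF this par(4)] show ?thesis using nz by blast
  qed
  thus ?thesis using SH hg unfolding kUSH_def by blast
qed

end

section \<open>The class and its convolution\<close>

definition tail_moduli :: "(nat \<Rightarrow> complex) \<Rightarrow> nat \<Rightarrow> real" where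
  "tail_moduli a n = (if n = 0 then 0 else norm (a (n + 1)))"

definition moduli :: "(nat \<Rightarrow> complex) \<Rightarrow> nat \<Rightarrow> real" where
  "moduli b n = norm (b (n + 1))"

lemma neg_series_eq_neg_map:
  assumes "neg_coeffs u (tail_moduli a) (moduli b)" and z: "norm z < 1"
  shows "neg_series u a b z = neg_coeffs.neg_map u (tail_moduli a) (moduli b) z"
    and "summable (\<lambda>n. of_real (norm (a (n + 2))) * z ^ (n + 2))"
    and "summable (\<lambda>n. of_real (norm (b (n + 1))) * cnj z ^ (n + 1))"
proof -
  interpret neg_coeffs u "tail_moduli a" "moduli b" by fact
  have "(\<lambda>n. z * (of_real (tail_moduli a n) * z ^ n)) sums shifted_sum (tail_moduli a) z"
    unfolding shifted_sum_def power_sum_def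
    by (intro sums_mult summable_sums disk_coeffs_summable A z)
  hence "(\<lambda>n. z * (of_real (tail_moduli a (Suc n)) * z ^ Suc n)) sums
      (shifted_sum (tail_moduli a) z - z * (of_real (tail_moduli a 0) * z ^ 0))"
    by (subst sums_Suc_iff) simp
  hence a: "(\<lambda>n. of_real (norm (a (n + 2))) * z ^ (n + 2)) sums shifted_sum (tail_moduli a) z"
    by (simp add: tail_moduli_def mult_ac power2_eq_square)
  have "(\<lambda>n. cnj z * (of_real (moduli b n) * cnj z ^ n)) sums shifted_sum (moduli b) (cnj z)"
    unfolding shifted_sum_def power_sum_def
    by (intro sums_mult summable_sums disk_coeffs_summable B) (use z in simp)
  hence b: "(\<lambda>n. of_real (norm (b (n + 1))) * cnj z ^ (n + 1)) sums shifted_sum (moduli b) (cnj z)"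
    by (simp add: moduli_def mult_ac)
  show "summable (\<lambda>n. of_real (norm (a (n + 2))) * z ^ (n + 2))"
    "summable (\<lambda>n. of_real (norm (b (n + 1))) * cnj z ^ (n + 1))"
    using a b by (auto simp: sums_iff)
  have "cnj (shifted_sum (moduli b) z) = shifted_sum (moduli b) (cnj z)"
    using z by (simp add: shifted_sum_def cnj_power_sum B)
  thus "neg_series u a b z = neg_map z"
    using a b z by (simp add: neg_map_eq neg_series_def sums_iff)
qed

lemma neg_coeffs_if_has_neg_series:
  assumes u: "1 \<le> u" and f: "has_neg_series u f a b"
  shows "neg_coeffs u (tail_moduli a) (moduli b)"
proof
  show "disk_coeffs (tail_moduli a)" unfolding disk_coeffs_def
  proof (intro allI impI)
    fix r :: real assume r: "0 \<le> r" "r < 1"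
    show "summable (\<lambda>n. \<bar>tail_moduli a n\<bar> * r ^ n)"
    proof (cases "r = 0")
      case True
      thus ?thesis by (intro summable_finite[of "{0}"]) auto
    next
      case False
      have "summable (\<lambda>n. complex_of_real (norm (a (n + 2))) * of_real r ^ (n + 2))"
        using f r unfolding has_neg_series_def by auto
      hence "summable (\<lambda>n. complex_of_real (norm (a (n + 2)) * r ^ (n + 2)))" by simp
      hence "summable (\<lambda>n. norm (a (n + 2)) * r ^ (n + 2) / r)"
        unfolding summable_complex_of_real by (rule summable_divide)
      hence "summable (\<lambda>n. \<bar>tail_moduli a (Suc n)\<bar> * r ^ Suc n)"
        using False by (simp add: tail_moduli_def mult_ac)
      thus ?thesis by (subst (asm) summable_Suc_iff)
    qed
  qed
  show "disk_coeffs (moduli b)" unfolding disk_coeffs_def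
  proof (intro allI impI)
    fix r :: real assume r: "0 \<le> r" "r < 1"
    show "summable (\<lambda>n. \<bar>moduli b n\<bar> * r ^ n)"
    proof (cases "r = 0")
      case True
      thus ?thesis by (intro summable_finite[of "{0}"]) auto
    next
      case False
      have "summable (\<lambda>n. complex_of_real (norm (b (n + 1))) * cnj (of_real r) ^ (n + 1))"
        using f r unfolding has_neg_series_def by (metis mem_ball_0 norm_of_real abs_of_nonneg)
      hence "summable (\<lambda>n. complex_of_real (norm (b (n + 1)) * r ^ (n + 1)))" by simp
      hence "summable (\<lambda>n. norm (b (n + 1)) * r ^ (n + 1) / r)"
        unfolding summable_complex_of_real by (rule summable_divide)
      thus ?thesis using False by (simp add: moduli_def mult_ac)
    qed
  qed
qed (use u in \<open>auto simp: tail_moduli_def moduli_def\<close>)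

text \<open>That \<open>|b 1| < 1\<close> holds for the given coefficients, and not only for some representation of \<open>f\<close>, is
  read off from the positive Jacobian at \<open>0\<close>.\<close>

lemma kUTH_coefficient_bounds:
  assumes par: "0 \<le> lam" "0 \<le> \<alpha>" "\<alpha> < 1" "0 \<le> k" "1 \<le> u" "v < u"
    and f: "f \<in> kUTH k u v \<alpha> lam" and ab: "has_neg_series u f a b"
  shows "neg_coeffs u (tail_moduli a) (moduli b)" and "norm (b 1) < 1"
    and "(\<Sum>n<N. (1 + real n) * (tail_moduli a n + moduli b n)) \<le> 1"
    and "(\<Sum>n<N. coefficient_weight k \<alpha> lam u v 1 n * tail_moduli a n
      + coefficient_weight k \<alpha> lam u v ((-1) ^ (u + v)) n * moduli b n) \<le> 1 - \<alpha>"
proof -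
  show nc: "neg_coeffs u (tail_moduli a) (moduli b)"
    by (rule neg_coeffs_if_has_neg_series[OF par(5) ab])
  interpret neg_coeffs u "tail_moduli a" "moduli b" by fact
  have eq: "f z = neg_map z" if "z \<in> unit_disk" for z
    using ab that neg_series_eq_neg_map(1)[OF nc, of z] by (simp add: has_neg_series_def)
  have kUSH: "f \<in> kUSH k u v \<alpha> lam" using f by (simp add: kUTH_def)
  hence SH: "f \<in> SH" by (simp add: kUSH_def)
  show "(\<Sum>n<N. (1 + real n) * (tail_moduli a n + moduli b n)) \<le> 1"
    by (rule partial_sums_le_if_SH[OF eq SH])
  have "0 \<in> unit_disk" by simp
  hence "(norm (wirtinger_bar f 0))\<^sup>2 < (norm (wirtinger f 0))\<^sup>2"
    using SH unfolding SH_def sense_preserving_on_def diff_gt_0_iff_gt by blast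
  hence "norm (wirtinger_bar f 0) < norm (wirtinger f 0)"
    by (rule power2_less_imp_less) simp
  hence "moduli b 0 < 1"
    using wirtinger_neg_map(2,3)[OF eq, of 0] SH moduli_def[of b 0]
    by (simp add: power_sum_def powser_zero A_0)
  thus "norm (b 1) < 1" by (simp add: moduli_def)
  thus "(\<Sum>n<N. coefficient_weight k \<alpha> lam u v 1 n * tail_moduli a n
      + coefficient_weight k \<alpha> lam u v ((-1) ^ (u + v)) n * moduli b n) \<le> 1 - \<alpha>"
    using par kUSH eq by (intro partial_sums_le_if_kUSH) (auto simp: moduli_def)
qed

lemma neg_series_in_kUTH:
  assumes par: "0 \<le> lam" "0 \<le> \<alpha>" "\<alpha> < 1" "0 \<le> k" "v < u"
    and nc: "neg_coeffs u (tail_moduli a) (moduli b)" and b1: "norm (b 1) < 1"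
    and SH: "\<And>N. (\<Sum>n<N. (1 + real n) * (tail_moduli a n + moduli b n)) \<le> 1"
    and kUSH: "\<And>N. (\<Sum>n<N. coefficient_weight k \<alpha> lam u v 1 n * tail_moduli a n
      + coefficient_weight k \<alpha> lam u v ((-1) ^ (u + v)) n * moduli b n) \<le> 1 - \<alpha>"
  shows "neg_series u a b \<in> kUTH k u v \<alpha> lam"
proof -
  interpret neg_coeffs u "tail_moduli a" "moduli b" by fact
  have eq: "neg_series u a b z = neg_map z" if "z \<in> unit_disk" for z
    using that neg_series_eq_neg_map(1)[OF nc, of z] by simp
  have b0: "moduli b 0 < 1" using b1 by (simp add: moduli_def)
  have "neg_series u a b \<in> kUSH k u v \<alpha> lam"
    by (rule neg_map_in_kUSH[OF par b0 eq neg_map_in_SH[OF eq b0 SH] kUSH])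
  moreover have "has_neg_series u (neg_series u a b) a b"
    unfolding has_neg_series_def using neg_series_eq_neg_map(2,3)[OF nc] by simp
  ultimately show ?thesis using b1 unfolding kUTH_def by blast
qed

theorem theorem2p5:
  fixes lam \<alpha> k :: real and u v :: nat
    and f\<^sub>u g\<^sub>u :: "complex \<Rightarrow> complex" and a b c d :: "nat \<Rightarrow> complex"
  assumes "lam \<ge> 0" and "0 \<le> \<alpha>" and "\<alpha> < 1" and "0 \<le> k" and "u \<ge> 1" and "u > v"
    and "f\<^sub>u \<in> kUTH k u v \<alpha> lam" and "has_neg_series u f\<^sub>u a b"
    and "g\<^sub>u \<in> kUTH k u v \<alpha> lam" and "has_neg_series u g\<^sub>u c d"
  shows "neg_convolution u a b c d \<in> kUTH k u v \<alpha> lam"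
proof -
  note F = kUTH_coefficient_bounds[OF assms(1-6,7,8)]
  note G = kUTH_coefficient_bounds[OF assms(1-6,9,10)]
  interpret F: neg_coeffs u "tail_moduli a" "moduli b" by (rule F(1))
  interpret G: neg_coeffs u "tail_moduli c" "moduli d" by (rule G(1))
  \<comment> \<open>A single term of the first coefficient inequality for the second factor.\<close>
  have cd: "tail_moduli c n \<le> 1" "moduli d n \<le> 1" for n
  proof -
    have "0 \<le> (1 + real m) * (tail_moduli c m + moduli d m)" for m
      using G.A_nonneg G.B_nonneg by simp
    hence "(1 + real n) * (tail_moduli c n + moduli d n) \<le> 1"
      using G(3)[of "Suc n"]
        member_le_sum[of n "{..<Suc n}" "\<lambda>n. (1 + real n) * (tail_moduli c n + moduli d n)"]
      by simp
    moreover have "1 * (tail_moduli c n + moduli d n) \<le> (1 + real n) * (tail_moduli c n + moduli d n)"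
      using G.A_nonneg G.B_nonneg by (intro mult_right_mono) auto
    ultimately show "tail_moduli c n \<le> 1" "moduli d n \<le> 1"
      using G.A_nonneg[of n] G.B_nonneg[of n] by auto
  qed
  let ?p = "\<lambda>n. a n * c n" and ?q = "\<lambda>n. b n * d n"
  have le: "tail_moduli ?p n \<le> tail_moduli a n" "moduli ?q n \<le> moduli b n" for n
    using cd[of n] by (auto simp: tail_moduli_def moduli_def norm_mult mult_left_le)
  have nn: "0 \<le> tail_moduli ?p n" "0 \<le> moduli ?q n" for n
    by (auto simp: tail_moduli_def moduli_def)
  have SH: "(\<Sum>n<N. (1 + real n) * (tail_moduli ?p n + moduli ?q n)) \<le> 1" for N
    by (rule order.trans[OF sum_mono F(3)[of N]]) (intro mult_left_mono add_mono le; simp)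
  note e0 = coefficient_weight_nonneg[OF assms(1-4,6)]
  have kUSH: "(\<Sum>n<N. coefficient_weight k \<alpha> lam u v 1 n * tail_moduli ?p n
      + coefficient_weight k \<alpha> lam u v ((-1) ^ (u + v)) n * moduli ?q n) \<le> 1 - \<alpha>" for N
    by (rule order.trans[OF sum_mono F(4)[of N]])
       (intro add_mono mult_left_mono le e0 sign_cases; simp)
  have "disk_coeffs (\<lambda>n. tail_moduli ?p n)" "disk_coeffs (\<lambda>n. moduli ?q n)"
  proof -
    have "tail_moduli ?p n \<le> (1 + real n) * (tail_moduli ?p n + moduli ?q n)"
      "moduli ?q n \<le> (1 + real n) * (tail_moduli ?p n + moduli ?q n)" for n
      using nn[of n] mult_right_mono[of 1 "1 + real n" "tail_moduli ?p n + moduli ?q n"] by auto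
    hence "sum (tail_moduli ?p) {..<N} \<le> 1" "sum (moduli ?q) {..<N} \<le> 1" for N
      using order.trans[OF sum_mono SH[of N]] by blast+
    thus "disk_coeffs (\<lambda>n. tail_moduli ?p n)" "disk_coeffs (\<lambda>n. moduli ?q n)"
      using disk_coeffs_if_partial_sums_le nn by blast+
  qed
  hence nc: "neg_coeffs u (tail_moduli ?p) (moduli ?q)"
    using nn assms(5) by unfold_locales (auto simp: tail_moduli_def[of _ 0])
  have "norm (?q 1) < 1"
    using F(2) le(2)[of 0] by (simp add: moduli_def)
  thus ?thesis
    unfolding neg_convolution_def
    using neg_series_in_kUTH[OF assms(1-4,6) nc _ SH kUSH] by simp
qed

end
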